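(* Let $N=(c_{ij})\in\mathrm{Mat}_n(\mathbb{Z})$ be an intersection matrix whose discriminant group $\Phi_N$ is killed by $2$. Then $N$ is numerically Gorenstein.
   Context: An $n\times n$ intersection matrix $N=(c_{ij})$ is a symmetric negative-definite integer matrix with negative coefficients on the diagonal and non-negative coefficients off the diagonal; its associated graph (vertices $v_1,\dots,v_n$, with $v_i\neq v_j$ joined by $c_{ij}$ edges) is tacitly assumed connected. The discriminant group is $\Phi_N=\mathbb{Z}^n/N\mathbb{Z}^n$. Let $H_0\in\mathbb{Z}^n$ be the integer vector whose $i$-th coefficient is $-c_{ii}-2$ for $i=1,\dots,n$. Since $N$ is invertible over $\mathbb{Q}$, there is a unique vector $K\in\mathbb{Q}^n$ with $NK=H_0$ (the canonical cycle of $N$). $N$ is called numerically Gorenstein if $K\in\mathbb{Z}^n$. *)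

theory Defs
  imports
    "HOL-Analysis.Analysis"
    "HOL-Algebra.Coset"
    "Graph_Theory.Digraph_Component"
begin

text \<open>
  The index set \<open>{1, \<dots>, n}\<close> is a finite type \<open>'n\<close>, so that
  \<open>n = CARD('n) \<ge> 1\<close> is arbitrary.
\<close>

definition negative_definite :: "int ^ 'n ^ 'n \<Rightarrow> bool" where
  "negative_definite N \<longleftrightarrow>
     (\<forall>x :: real ^ 'n. x \<noteq> 0 \<longrightarrow> x \<bullet> (map_matrix real_of_int N *v x) < 0)"

text \<open>
  Undirected multigraphs are represented as bidirected ones: each of the \<open>c\<^sub>i\<^sub>j\<close>
  edges joining \<open>i \<noteq> j\<close> gives the two opposite arcs \<open>(i, j, k)\<close> and \<open>(j, i, k)\<close>,
  where \<open>k < c\<^sub>i\<^sub>j\<close>.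
\<close>

definition associated_graph :: "int ^ 'n ^ 'n \<Rightarrow> ('n, 'n \<times> 'n \<times> nat) pre_digraph" where
  "associated_graph N =
     \<lparr>verts = UNIV,
      arcs = {(i, j, k). i \<noteq> j \<and> int k < N $ i $ j},
      tail = (\<lambda>(i, j, k). i),
      head = (\<lambda>(i, j, k). j)\<rparr>"

definition intersection_matrix :: "int ^ 'n ^ 'n \<Rightarrow> bool" where
  "intersection_matrix N \<longleftrightarrow>
     transpose N = N \<and>
     negative_definite N \<and>
     (\<forall>i. N $ i $ i < 0) \<and>
     (\<forall>i j. i \<noteq> j \<longrightarrow> 0 \<le> N $ i $ j) \<and>
     Digraph_Component.connected (associated_graph N)"

definition int_vec_group :: "(int ^ 'n) monoid" where
  "int_vec_group = \<lparr>carrier = UNIV, monoid.mult = (+), one = 0\<rparr>"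

definition discriminant_group :: "int ^ 'n ^ 'n \<Rightarrow> (int ^ 'n) set monoid" where
  "discriminant_group N = int_vec_group Mod range (\<lambda>x. N *v x)"

definition H0_vec :: "int ^ 'n ^ 'n \<Rightarrow> int ^ 'n" where
  "H0_vec N = (\<chi> i. - (N $ i $ i) - 2)"

definition canonical_cycle :: "int ^ 'n ^ 'n \<Rightarrow> rat ^ 'n" where
  "canonical_cycle N =
     (THE K. map_matrix rat_of_int N *v K = (\<chi> i. rat_of_int (H0_vec N $ i)))"

definition numerically_Gorenstein :: "int ^ 'n ^ 'n \<Rightarrow> bool" where
  "numerically_Gorenstein N \<longleftrightarrow> (\<forall>i. canonical_cycle N $ i \<in> \<int>)"

lemma comm_group_int_vec_group: "comm_group (int_vec_group :: (int ^ 'n) monoid)"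
proof (rule comm_groupI)
  fix x :: "int ^ 'n"
  show "\<exists>y\<in>carrier int_vec_group. y \<otimes>\<^bsub>int_vec_group\<^esub> x = \<one>\<^bsub>int_vec_group\<^esub>"
    by (rule bexI[of _ "- x"]) (simp_all add: int_vec_group_def)
qed (simp_all add: int_vec_group_def algebra_simps)

lemma comm_group_discriminant_group: "comm_group (discriminant_group N)"
proof -
  interpret comm_group "int_vec_group :: (int ^ 'n) monoid"
    by (rule comm_group_int_vec_group)
  have "subgroup (range (\<lambda>x. N *v x)) int_vec_group"
  proof (rule subgroupI)
    fix a assume "a \<in> range (\<lambda>x. N *v x)"
    then obtain x where x: "a = N *v x" by blast
    have "N *v (- x) + a = 0"
      unfolding x matrix_vector_right_distrib[symmetric] by simp
    then have "inv\<^bsub>int_vec_group\<^esub> a = N *v (- x)"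
      by (intro inv_equality) (simp_all add: int_vec_group_def)
    then show "inv\<^bsub>int_vec_group\<^esub> a \<in> range (\<lambda>x. N *v x)" by blast
  next
    fix a b assume "a \<in> range (\<lambda>x. N *v x)" "b \<in> range (\<lambda>x. N *v x)"
    then obtain x y where "a = N *v x" "b = N *v y" by blast
    then have "a + b = N *v (x + y)" by (simp only: matrix_vector_right_distrib)
    then show "a \<otimes>\<^bsub>int_vec_group\<^esub> b \<in> range (\<lambda>x. N *v x)"
      by (simp add: int_vec_group_def)
  qed (simp_all add: int_vec_group_def)
  then show ?thesis
    unfolding discriminant_group_def by (rule abelian_FactGroup)
qed

lemma negative_definite_ex1_solution:
  fixes N :: "int ^ 'n ^ 'n" and b :: "rat ^ 'n"
  assumes "negative_definite N"
  shows "\<exists>!K. map_matrix rat_of_int N *v K = b"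
proof -
  let ?M = "map_matrix rat_of_int N"
  have ker: "x = 0" if "?M *v x = 0" for x
  proof (rule ccontr)
    assume "x \<noteq> 0"
    let ?y = "(\<chi> i. real_of_rat (x $ i)) :: real ^ 'n"
    have "?y \<noteq> 0" using \<open>x \<noteq> 0\<close> by (auto simp: vec_eq_iff)
    moreover have "map_matrix real_of_int N *v ?y = 0"
    proof -
      have "(\<Sum>j\<in>UNIV. real_of_int (N $ i $ j) * real_of_rat (x $ j)) = 0" for i
      proof -
        have "(?M *v x) $ i = 0" using that by simp
        then have "(\<Sum>j\<in>UNIV. rat_of_int (N $ i $ j) * x $ j) = 0"
          by (simp add: matrix_vector_mult_def)
        then have "real_of_rat (\<Sum>j\<in>UNIV. rat_of_int (N $ i $ j) * x $ j) = 0" by simp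
        then show ?thesis by (simp add: of_rat_sum of_rat_mult)
      qed
      then show ?thesis by (simp add: vec_eq_iff matrix_vector_mult_def)
    qed
    ultimately show False
      using assms unfolding negative_definite_def by (metis inner_zero_right less_irrefl)
  qed
  have "\<exists>B. B ** ?M = mat 1"
    unfolding matrix_left_invertible_ker by (intro allI impI) (rule ker)
  then obtain B where B: "B ** ?M = mat 1"
    ..
  then have "?M ** B = mat 1"
    by (simp only: matrix_left_right_inverse)
  then have "?M *v (B *v b) = b"
    by (simp only: matrix_vector_mul_assoc matrix_vector_mul_lid)
  moreover have "K = B *v b" if "?M *v K = b" for K
    unfolding that[symmetric] by (simp only: matrix_vector_mul_assoc B matrix_vector_mul_lid)
  ultimately show ?thesis by (rule ex1I)
qed

end

theory Submission
  imports Defs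
begin

text \<open>
  As \<open>2\<close> kills the discriminant group, there are integer vectors \<open>m\<^sub>i\<close> with \<open>N m\<^sub>i = 2 e\<^sub>i\<close>.
  By symmetry of \<open>N\<close>, \<open>2 K\<^sub>i = m\<^sub>i \<bullet> N K = m\<^sub>i \<bullet> H\<^sub>0\<close>. Modulo \<open>2\<close>, the vector \<open>H\<^sub>0\<close> is the diagonal of
  \<open>N\<close>, and the pairing of \<open>x\<close> with that diagonal is the quadratic form \<open>x \<bullet> N x\<close>. So
  \<open>2 K\<^sub>i \<equiv> m\<^sub>i \<bullet> N m\<^sub>i = 2 m\<^sub>i\<^sub>i \<equiv> 0\<close>, that is, \<open>K\<^sub>i\<close> is an integer.
\<close>

text \<open>The off-diagonal terms \<open>f i j\<close> and \<open>f j i\<close> are equal, so they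
  pair up to even numbers. The induction adds the row and the column of \<open>a\<close>, whose
  off-diagonal parts have the same sum.\<close>

lemma even_double_sum_diff_diagonal:
  fixes f :: "'a \<Rightarrow> 'a \<Rightarrow> int"
  assumes "finite S" and sym: "\<And>i j. f i j = f j i"
  shows "even ((\<Sum>i\<in>S. \<Sum>j\<in>S. f i j) - (\<Sum>i\<in>S. f i i))"
  using assms(1)
proof (induction S rule: finite_induct)
  case empty
  show ?case by simp
next
  case (insert a S)
  have "(\<Sum>j\<in>S. f j a) = (\<Sum>j\<in>S. f a j)"
    by (intro sum.cong refl sym)
  with insert.hyps
  have "(\<Sum>i\<in>insert a S. \<Sum>j\<in>insert a S. f i j) - (\<Sum>i\<in>insert a S. f i i)
      = 2 * (\<Sum>j\<in>S. f a j) + ((\<Sum>i\<in>S. \<Sum>j\<in>S. f i j) - (\<Sum>i\<in>S. f i i))"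
    by (simp add: sum.distrib)
  with insert.IH show ?case by simp
qed

lemma even_quadratic_form_diff_diagonal:
  fixes A :: "int ^ 'n ^ 'n" and x :: "int ^ 'n"
  assumes "transpose A = A"
  shows "even ((\<Sum>i\<in>UNIV. x $ i * (A *v x) $ i) - (\<Sum>i\<in>UNIV. x $ i * A $ i $ i))"
proof -
  have sym: "A $ i $ j = A $ j $ i" for i j
    using arg_cong[OF assms, of "\<lambda>B. B $ j $ i"] by (simp add: transpose_def)
  have "(\<Sum>i\<in>UNIV. x $ i * (A *v x) $ i) = (\<Sum>i\<in>UNIV. \<Sum>j\<in>UNIV. x $ i * A $ i $ j * x $ j)"
    by (simp add: matrix_vector_mult_def sum_distrib_left mult.assoc)
  moreover have "even ((\<Sum>i\<in>UNIV. \<Sum>j\<in>UNIV. x $ i * A $ i $ j * x $ j)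
                    - (\<Sum>i\<in>UNIV. x $ i * A $ i $ i * x $ i))"
  proof (rule even_double_sum_diff_diagonal)
    show "x $ i * A $ i $ j * x $ j = x $ j * A $ j $ i * x $ i" for i j
      unfolding sym[of i j] by (simp only: ac_simps)
  qed simp
  \<comment> \<open>Termwise, \<open>x $ i * (x $ i - 1)\<close> is even; this makes the diagonal
    part linear in \<open>x\<close> modulo 2.\<close>
  moreover have "even ((\<Sum>i\<in>UNIV. x $ i * A $ i $ i * x $ i) - (\<Sum>i\<in>UNIV. x $ i * A $ i $ i))"
    unfolding sum_subtractf[symmetric] by (intro dvd_sum) auto
  ultimately show ?thesis
    by simp
qed

text \<open>Adjointness of \<open>A\<close> and its transpose, by exchanging the two sums. It serves
  to move the matrix from \<open>K\<close> to \<open>m\<close> over the rationals.\<close>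

lemma sum_mult_matrix_vector_transpose:
  fixes A :: "'a :: comm_semiring_1 ^ 'n ^ 'm"
  shows "(\<Sum>i\<in>UNIV. x $ i * (A *v y) $ i) = (\<Sum>j\<in>UNIV. (transpose A *v x) $ j * y $ j)"
proof -
  have "(\<Sum>i\<in>UNIV. x $ i * (A *v y) $ i) = (\<Sum>i\<in>UNIV. \<Sum>j\<in>UNIV. A $ i $ j * x $ i * y $ j)"
    by (simp add: matrix_vector_mult_def sum_distrib_left ac_simps)
  also have "\<dots> = (\<Sum>j\<in>UNIV. \<Sum>i\<in>UNIV. A $ i $ j * x $ i * y $ j)"
    by (rule sum.swap)
  also have "\<dots> = (\<Sum>j\<in>UNIV. (transpose A *v x) $ j * y $ j)"
    by (simp add: matrix_vector_mult_def transpose_def sum_distrib_right)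
  finally show ?thesis .
qed

text \<open>The square of the coset of \<open>v\<close> is the unit coset, which is the image of
  \<open>N\<close> itself. As an elementwise product of sets, this square contains
  \<open>v + v\<close>.\<close>

lemma double_in_range_if_discriminant_group_square_trivial:
  fixes N :: "int ^ 'n ^ 'n" and v :: "int ^ 'n"
  assumes "\<forall>x \<in> carrier (discriminant_group N).
             x [^]\<^bsub>discriminant_group N\<^esub> (2 :: nat) = \<one>\<^bsub>discriminant_group N\<^esub>"
  shows "v + v \<in> range (\<lambda>x. N *v x)"
proof -
  interpret comm_group "discriminant_group N"
    by (rule comm_group_discriminant_group)
  let ?R = "range (\<lambda>x. N *v x)"
  let ?c = "?R #>\<^bsub>int_vec_group\<^esub> v"
  have c: "?c \<in> carrier (discriminant_group N)"
    by (auto simp: discriminant_group_def FactGroup_def RCOSETS_def int_vec_group_def)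
  have "?c <#>\<^bsub>int_vec_group\<^esub> ?c = ?c \<otimes>\<^bsub>discriminant_group N\<^esub> ?c"
    by (simp add: discriminant_group_def FactGroup_def)
  also have "\<dots> = ?c [^]\<^bsub>discriminant_group N\<^esub> (2 :: nat)"
    using c by (simp add: numeral_2_eq_2)
  also have "\<dots> = ?R"
    using assms c by (simp add: discriminant_group_def FactGroup_def)
  finally have "?c <#>\<^bsub>int_vec_group\<^esub> ?c = ?R" .
  moreover have "v \<in> ?c"
    by (auto simp: r_coset_def int_vec_group_def intro!: exI[of _ 0])
  ultimately have "v \<otimes>\<^bsub>int_vec_group\<^esub> v \<in> ?R"
    unfolding set_mult_def by blast
  then show ?thesis
    by (simp add: int_vec_group_def)
qed

theorem proposition10p5:
  fixes N :: "int ^ 'n ^ 'n"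
  assumes "intersection_matrix N"
    and "\<forall>x \<in> carrier (discriminant_group N).
           x [^]\<^bsub>discriminant_group N\<^esub> (2 :: nat) = \<one>\<^bsub>discriminant_group N\<^esub>"
  shows "numerically_Gorenstein N"
  unfolding numerically_Gorenstein_def
proof
  fix i :: 'n
  let ?Q = "map_matrix rat_of_int N"
  let ?K = "canonical_cycle N"
  have sym: "transpose N = N" and nd: "negative_definite N"
    using assms(1) by (auto simp: intersection_matrix_def)
  have K: "?Q *v ?K = (\<chi> i. rat_of_int (H0_vec N $ i))"
    unfolding canonical_cycle_def
    by (rule theI') (rule negative_definite_ex1_solution[OF nd])
  have "axis i 1 + axis i 1 \<in> range (\<lambda>x. N *v x)"
    using assms(2) by (rule double_in_range_if_discriminant_group_square_trivial)
  \<comment> \<open>Thus \<open>m\<close> is column \<open>i\<close> of twice the inverse of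
    \<open>N\<close>, and the hypothesis on the discriminant group makes it integral.\<close>
  then obtain m where "axis i 1 + axis i 1 = N *v m"
    ..
  then have m: "(N *v m) $ j = (if j = i then 2 else 0)" for j
    by (simp flip: \<open>_ = N *v m\<close> add: axis_def)
  let ?m = "(\<chi> j. rat_of_int (m $ j)) :: rat ^ 'n"
  \<comment> \<open>The computation passes to the rationals, as \<open>?K\<close> is not yet known
    to be integral.\<close>
  have Qm: "(transpose ?Q *v ?m) $ j = (if j = i then 2 else 0)" for j
  proof -
    have "transpose ?Q = ?Q"
      using sym by (simp add: vec_eq_iff transpose_def)
    then have "(transpose ?Q *v ?m) $ j = rat_of_int ((N *v m) $ j)"
      by (simp add: matrix_vector_mult_def)
    then show ?thesis by (simp add: m)
  qed
  have "rat_of_int (\<Sum>j\<in>UNIV. m $ j * H0_vec N $ j) = (\<Sum>j\<in>UNIV. ?m $ j * (?Q *v ?K) $ j)"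
    by (simp add: K)
  also have "\<dots> = 2 * ?K $ i"
    unfolding sum_mult_matrix_vector_transpose Qm by (simp add: if_distrib[of "\<lambda>x. x * _"] cong: if_cong)
  finally have two_K: "rat_of_int (\<Sum>j\<in>UNIV. m $ j * H0_vec N $ j) = 2 * ?K $ i" .
  have "(\<Sum>j\<in>UNIV. m $ j * (N *v m) $ j) = 2 * m $ i"
    unfolding m by (simp add: if_distrib[of "\<lambda>x. _ * x"] cong: if_cong)
  with even_quadratic_form_diff_diagonal[OF sym, of m]
  have "even (\<Sum>j\<in>UNIV. m $ j * N $ j $ j)"
    by simp
  \<comment> \<open>Modulo 2 the sign and the constant 2 in \<open>H0_vec\<close> disappear, which
    leaves the pairing of \<open>m\<close> with the diagonal.\<close>
  moreover have "(\<Sum>j\<in>UNIV. m $ j * H0_vec N $ j)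
      = - (\<Sum>j\<in>UNIV. m $ j * N $ j $ j) - 2 * (\<Sum>j\<in>UNIV. m $ j)"
    by (simp add: H0_vec_def right_diff_distrib sum_subtractf sum_negf sum_distrib_left mult.commute)
  ultimately have "even (\<Sum>j\<in>UNIV. m $ j * H0_vec N $ j)"
    by simp
  then obtain k where "(\<Sum>j\<in>UNIV. m $ j * H0_vec N $ j) = 2 * k"
    by (elim evenE)
  with two_K have "?K $ i = rat_of_int k"
    by simp
  then show "?K $ i \<in> \<int>"
    by simp
qed

end
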